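(* Let $y\ge1$ be an integer and let $k\ge0$ be the integer with $2^k\le y<2^{k+1}$. Then $\text{c-Ulam}[y]$ is biperiodic with biperiod $2^{k+1}\times2^{k+1}$, i.e. for all $x,z\in\mathbb{N}$, $$\text{c-Ulam}[y](x+2^{k+1},z)=\text{c-Ulam}[y](x,z)=\text{c-Ulam}[y](x,z+2^{k+1}).$$
   Context: $\mathbb{N}=\{0,1,2,\dots\}$. Ulam words are binary words defined recursively: $\mathcal{U}(1)=\{0,1\}$, and for $n>1$, $\mathcal{U}(n)$ is the set of all words of length $n$ over $\{0,1\}$ that are expressible uniquely as a concatenation $uv$ of two distinct words $u\in\mathcal{U}(i)$, $v\in\mathcal{U}(j)$ with $i,j<n$ (i.e. there is exactly one ordered pair $(u,v)$ of such words, $u\ne v$). A word is Ulam if it belongs to $\bigcup_{n\ge1}\mathcal{U}(n)$. $0^m$ denotes a block of $m$ zeros. The labeling $\text{c-Ulam}[y]:\mathbb{N}^2\to\{0,1,2\}$ is defined by letting $\text{c-Ulam}[y](x,z)$ be the minimum of $2$ and the number of representations of $0^x10^y10^z$ as a concatenation of two (not necessarily distinct) Ulam words with exactly one $1$ each, i.e. the number of integers $a$, $0\le a\le y$, such that both $0^x10^a$ and $0^{y-a}10^z$ are Ulam. *)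

theory Defs
  imports Main
begin

text \<open>
  Binary words are lists of booleans, with \<open>False\<close> for the letter \<open>0\<close> and \<open>True\<close> for \<open>1\<close>.
  The index of \<open>ulam\<close> starts at 1; the value at 0 is a dummy.  Uniqueness is that of the
  ordered pair of words; by induction the lengths \<open>i\<close> and \<open>j\<close> are determined by the words.
\<close>

fun ulam :: "nat \<Rightarrow> bool list set" where
  "ulam 0 = {}"
| "ulam (Suc 0) = {[False], [True]}"
| "ulam (Suc (Suc n)) =
    {w. length w = Suc (Suc n) \<and>
        (\<exists>!(u, v). u \<noteq> v \<and> w = u @ v \<and>
           (\<exists>i\<in>{1..<Suc (Suc n)}. u \<in> ulam i) \<and>
           (\<exists>j\<in>{1..<Suc (Suc n)}. v \<in> ulam j))}"

definition is_ulam :: "bool list \<Rightarrow> bool" where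
  "is_ulam w \<longleftrightarrow> w \<in> (\<Union>n\<in>{1..}. ulam n)"

definition one_word :: "nat \<Rightarrow> nat \<Rightarrow> bool list" where
  "one_word p q = replicate p False @ True # replicate q False"

text \<open>
  The word \<open>0\<^sup>x 1 0\<^sup>y 1 0\<^sup>z\<close> is split inside (or at an end of) its middle block of zeros, so that
  either factor contains exactly one \<open>1\<close>; the two factors may coincide.
\<close>

definition c_ulam :: "nat \<Rightarrow> nat \<Rightarrow> nat \<Rightarrow> nat" where
  "c_ulam y x z = min 2 (card {a. a \<le> y \<and> is_ulam (one_word x a) \<and> is_ulam (one_word (y - a) z)})"

end

(* Among the words 0^n only 0 itself is Ulam, so 0^p 1 0^q can only be split by detaching a single
   zero at one of its ends.  Hence Ulamness of 0^p 1 0^q satisfies Pascal's recurrence modulo 2 and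
   means that the binomial coefficient C(p+q, p) is odd.  Doubling turns this recurrence into one
   with step 2^m, which yields period 2^m in p for each q < 2^m. *)

theory Submission
  imports Defs
begin

lemma length_ulam: "w \<in> ulam n \<Longrightarrow> length w = n"
  by (cases n rule: ulam.cases) auto

lemma is_ulam_iff: "is_ulam w \<longleftrightarrow> w \<noteq> [] \<and> w \<in> ulam (length w)"
  unfolding is_ulam_def by (auto dest: length_ulam simp: Suc_le_eq)

text \<open>Ulam words are nonempty, so both factors of a split are shorter than \<open>w\<close>
  and meet the index bounds in \<open>ulam\<close>. This recursion on words alone drives everything
  below.\<close>

lemma is_ulam_append_iff:
  assumes "2 \<le> length w"
  shows "is_ulam w \<longleftrightarrow> (\<exists>!(u, v). u \<noteq> v \<and> w = u @ v \<and> is_ulam u \<and> is_ulam v)"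
proof -
  obtain n where n: "length w = Suc (Suc n)"
    using assms by (metis Suc_le_D numeral_2_eq_2 Suc_le_mono)
  have bounded: "(\<exists>i\<in>{1..<Suc (Suc n)}. u \<in> ulam i) \<longleftrightarrow> is_ulam u" if "length u < Suc (Suc n)" for u
    using that by (force simp: is_ulam_def dest: length_ulam)
  have "(u \<noteq> v \<and> w = u @ v \<and> (\<exists>i\<in>{1..<Suc (Suc n)}. u \<in> ulam i) \<and> (\<exists>j\<in>{1..<Suc (Suc n)}. v \<in> ulam j))
      \<longleftrightarrow> (u \<noteq> v \<and> w = u @ v \<and> is_ulam u \<and> is_ulam v)" (is "?L \<longleftrightarrow> ?R") for u v
  proof
    assume ?L
    then have "length u < Suc (Suc n)" "length v < Suc (Suc n)"
      by (auto dest: length_ulam)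
    with \<open>?L\<close> show ?R by (simp only: bounded simp_thms)
  next
    assume ?R
    then have "u \<noteq> []" "v \<noteq> []" "length u + length v = Suc (Suc n)"
      using n by (auto simp: is_ulam_iff)
    then have "length u < Suc (Suc n)" "length v < Suc (Suc n)"
      by (auto simp flip: length_greater_0_conv)
    with \<open>?R\<close> show ?L by (simp only: bounded simp_thms)
  qed
  moreover have "w \<noteq> []" using n by auto
  ultimately show ?thesis
    using n by (simp add: is_ulam_iff[of w])
qed

lemma is_ulam_singleton: "is_ulam [b]"
  by (cases b) (simp_all add: is_ulam_iff)

lemma replicate_eq_append_iff:
  "replicate n x = u @ v \<longleftrightarrow> (\<exists>i j. n = i + j \<and> u = replicate i x \<and> v = replicate j x)"
proof
  assume split: "replicate n x = u @ v"
  then have "u = take (length u) (replicate n x)" "v = drop (length u) (replicate n x)"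
    by simp_all
  moreover have "n = length u + length v"
    using arg_cong[OF split, of length] by simp
  ultimately show "\<exists>i j. n = i + j \<and> u = replicate i x \<and> v = replicate j x"
    by (metis length_replicate take_replicate drop_replicate)
qed (auto simp: replicate_add)

text \<open>Strong induction: if a block of at least two zeros splits into two Ulam words, both are
  shorter blocks of zeros, hence both are \<open>[False]\<close>, against distinctness.\<close>

lemma is_ulam_replicate_False: "is_ulam (replicate n False) \<longleftrightarrow> n = 1"
proof (induction n rule: less_induct)
  case (less n)
  consider "n = 0" | "n = 1" | "2 \<le> n" by linarith
  then show ?case
  proof cases
    case 3
    have "u = v" if split: "replicate n False = u @ v" and uv: "is_ulam u" "is_ulam v" for u v
    proof -
      obtain i j where ij: "n = i + j" "u = replicate i False" "v = replicate j False"
        using split by (auto simp: replicate_eq_append_iff)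
      moreover have "i \<noteq> 0" "j \<noteq> 0" using ij uv by (auto simp: is_ulam_iff)
      ultimately show "u = v" using less.IH[of i] less.IH[of j] uv by simp
    qed
    then show ?thesis
      using 3 by (auto simp: is_ulam_append_iff)
  next
    case 1
    then show ?thesis by (simp add: is_ulam_iff)
  next
    case 2
    then show ?thesis by (simp add: is_ulam_singleton)
  qed
qed

text \<open>The cut lies either before the letter \<open>True\<close> or after it. The induction
  peels leading zeros off \<open>u\<close>.\<close>

lemma one_word_eq_append_iff:
  "one_word p q = u @ v \<longleftrightarrow>
     (\<exists>i p'. p = i + p' \<and> u = replicate i False \<and> v = one_word p' q) \<or>
     (\<exists>q' j. q = q' + j \<and> u = one_word p q' \<and> v = replicate j False)"
proof (induction p arbitrary: u)
  case 0
  show ?case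
    by (cases u) (auto simp: one_word_def replicate_eq_append_iff)
next
  case (Suc p)
  show ?case
  proof (cases u)
    case Nil
    then show ?thesis by (auto simp: one_word_def)
  next
    case (Cons b w)
    have zeros: "(\<exists>i p'. Suc p = i + p' \<and> b # w = replicate i False \<and> v = one_word p' q) \<longleftrightarrow>
        \<not> b \<and> (\<exists>i p'. p = i + p' \<and> w = replicate i False \<and> v = one_word p' q)"
      (is "?L \<longleftrightarrow> ?R")
    proof
      assume ?L
      then obtain i p' where "Suc p = i + p'" "b # w = replicate i False" "v = one_word p' q"
        by blast
      then show ?R by (cases i) auto
    next
      assume ?R
      then obtain i p' where "p = i + p'" "b # w = replicate (Suc i) False" "v = one_word p' q"
        by auto
      then show ?L by (intro exI[of _ "Suc i"] exI[of _ p']) simp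
    qed
    have Suc_left: "one_word (Suc p) q = False # one_word p q" for q
      by (simp add: one_word_def)
    show ?thesis
      unfolding Cons zeros using Suc.IH[of w] by (auto simp: Suc_left)
  qed
qed

lemma one_word_neq_replicate_False: "one_word p q \<noteq> replicate n False"
proof
  assume "one_word p q = replicate n False"
  then have "True \<in> set (replicate n False)"
    by (metis in_set_conv_decomp one_word_def)
  then show False by simp
qed

text \<open>The factor without \<open>True\<close> is an Ulam block of zeros, hence a single zero.
  Conversely, the two factors differ since only one of them contains \<open>True\<close>.\<close>

lemma one_word_split_into_ulam_iff:
  "u \<noteq> v \<and> one_word p q = u @ v \<and> is_ulam u \<and> is_ulam v \<longleftrightarrow>
     (\<exists>p'. p = Suc p' \<and> u = [False] \<and> v = one_word p' q \<and> is_ulam v) \<or>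
     (\<exists>q'. q = Suc q' \<and> u = one_word p q' \<and> v = [False] \<and> is_ulam u)"
  (is "?L \<longleftrightarrow> ?R")
proof
  assume ?L
  then show ?R
    by (auto simp: one_word_eq_append_iff is_ulam_replicate_False)
next
  assume ?R
  then show ?L
    using one_word_neq_replicate_False[of _ _ 1]
    by (auto simp: is_ulam_singleton one_word_def replicate_append_same dest: sym)
qed

definition one_ulam :: "nat \<Rightarrow> nat \<Rightarrow> bool" where
  "one_ulam p q \<longleftrightarrow> is_ulam (one_word p q)"

text \<open>There are at most two candidate splits, one detaching the first zero and one the last,
  so unique representability becomes an exclusive or.\<close>

lemma one_ulam_iff:
  assumes "p + q \<ge> 1"
  shows "one_ulam p q \<longleftrightarrow>
    ((\<exists>p'. p = Suc p' \<and> one_ulam p' q) \<noteq> (\<exists>q'. q = Suc q' \<and> one_ulam p q'))"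
proof -
  have neq: "one_word i j \<noteq> [False]" for i j
    using one_word_neq_replicate_False[of i j 1] by simp
  \<comment> \<open>The condition \<open>e \<noteq> c\<close> keeps the two candidate pairs apart:
    if \<open>P\<close> and \<open>Q\<close> both held for one and the same pair, that pair would
    still be unique.\<close>
  have unique: "(\<exists>!(u, v). (u = c \<and> v = d \<and> P) \<or> (u = e \<and> v = c \<and> Q)) \<longleftrightarrow> P \<noteq> Q"
    if "e \<noteq> c" for c d e :: "bool list" and P Q
    using that by (cases P; cases Q) (auto simp: Ex1_def)
  \<comment> \<open>The witnesses are named \<open>p - 1\<close> and \<open>q - 1\<close> to reach
    the shape of \<open>unique\<close>; their truncated values at 0 are harmless because the
    existential conjunct then fails.\<close>
  have "(\<exists>p'. p = Suc p' \<and> u = [False] \<and> v = one_word p' q \<and> is_ulam v) \<or>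
        (\<exists>q'. q = Suc q' \<and> u = one_word p q' \<and> v = [False] \<and> is_ulam u) \<longleftrightarrow>
      (u = [False] \<and> v = one_word (p - 1) q \<and> (\<exists>p'. p = Suc p' \<and> one_ulam p' q)) \<or>
      (u = one_word p (q - 1) \<and> v = [False] \<and> (\<exists>q'. q = Suc q' \<and> one_ulam p q'))" for u v
    unfolding one_ulam_def by (cases p; cases q) auto
  moreover have "2 \<le> length (one_word p q)"
    using assms by (simp add: one_word_def)
  ultimately show ?thesis
    by (simp only: one_ulam_def[of p q] is_ulam_append_iff one_word_split_into_ulam_iff unique[OF neq])
qed

lemma one_ulam_simps:
  "one_ulam 0 q"
  "one_ulam p 0"
  "one_ulam (Suc p) (Suc q) \<longleftrightarrow> one_ulam p (Suc q) \<noteq> one_ulam (Suc p) q"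
proof -
  have base: "one_ulam 0 0"
    using is_ulam_singleton by (simp add: one_ulam_def one_word_def)
  show "one_ulam 0 q" by (induction q) (simp_all add: base one_ulam_iff[of 0 "Suc _"])
  show "one_ulam p 0" by (induction p) (simp_all add: base one_ulam_iff[of "Suc _" 0])
  show "one_ulam (Suc p) (Suc q) \<longleftrightarrow> one_ulam p (Suc q) \<noteq> one_ulam (Suc p) q"
    by (subst one_ulam_iff) auto
qed

text \<open>Both the boundary values and the recurrence are symmetric in \<open>p\<close> and
  \<open>q\<close>.\<close>

lemma one_ulam_commute: "one_ulam p q = one_ulam q p"
proof (induction p arbitrary: q)
  case (Suc p)
  show ?case
    by (induction q) (auto simp: Suc.IH one_ulam_simps)
qed (simp add: one_ulam_simps)

text \<open>Addition modulo 2 makes doubling work: expanding the two terms of the recurrence with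
  step \<open>2 ^ m\<close> once more produces \<open>one_ulam (p + 2 ^ m) (q + 2 ^ m)\<close>
  twice, and it cancels.\<close>

lemma one_ulam_add_power2:
  "one_ulam (p + 2 ^ m) (q + 2 ^ m) \<longleftrightarrow> one_ulam p (q + 2 ^ m) \<noteq> one_ulam (p + 2 ^ m) q"
proof (induction m arbitrary: p q)
  case 0
  then show ?case by (simp add: one_ulam_simps)
next
  case (Suc m)
  show ?case
    using Suc.IH[of "p + 2 ^ m" "q + 2 ^ m"] Suc.IH[of p "q + 2 ^ m"] Suc.IH[of "p + 2 ^ m" q]
    by (auto simp: mult_2 add.assoc)
qed

lemma one_ulam_period_left:
  "q < 2 ^ m \<Longrightarrow> one_ulam (p + 2 ^ m) q = one_ulam p q"
proof (induction m arbitrary: p q)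
  case 0
  then show ?case by (simp add: one_ulam_simps)
next
  case (Suc m)
  \<comment> \<open>Below \<open>2 ^ m\<close> the old period already applies, and two such shifts
    make one by \<open>2 ^ Suc m\<close>.\<close>
  have double: "one_ulam (p + 2 ^ Suc m) r = one_ulam p r" if "r < 2 ^ m" for r
    using Suc.IH[OF that, of p] Suc.IH[OF that, of "p + 2 ^ m"] by (simp add: mult_2 add.assoc)
  show ?case
  proof (cases "q < 2 ^ m")
    case False
    define r where "r = q - 2 ^ m"
    have q: "q = r + 2 ^ m" and r: "r < 2 ^ m"
      using False Suc.prems by (auto simp: r_def)
    show ?thesis
      \<comment> \<open>Two uses of the recurrence lower the first argument from
        \<open>p + 2 ^ Suc m\<close> to \<open>p\<close> and leave the correction terms
        \<open>one_ulam (p + 2 ^ Suc m) r\<close> and \<open>one_ulam (p + 2 ^ m) r\<close>. By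
        periodicity both equal \<open>one_ulam p r\<close>, so they cancel.\<close>
      using one_ulam_add_power2[of "p + 2 ^ m" m r] one_ulam_add_power2[of p m r]
        Suc.IH[OF r, of p] double[OF r]
      by (auto simp: q mult_2 add.assoc)
  qed (rule double)
qed

lemma one_ulam_period_right:
  "p < 2 ^ m \<Longrightarrow> one_ulam p (q + 2 ^ m) = one_ulam p q"
  by (metis one_ulam_commute one_ulam_period_left)

theorem lemma1p6:
  fixes y k :: nat
  assumes "y \<ge> 1"
    and "2 ^ k \<le> y"
    and "y < 2 ^ (k + 1)"
  shows "\<forall>x z :: nat.
    c_ulam y (x + 2 ^ (k + 1)) z = c_ulam y x z \<and>
    c_ulam y x z = c_ulam y x (z + 2 ^ (k + 1))"
proof (intro allI conjI)
  fix x z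
  \<comment> \<open>Every cut puts \<open>a\<close> zeros in one factor and \<open>y - a\<close> in
    the other, both below \<open>2 ^ (k + 1)\<close>. Shifting \<open>x\<close> or \<open>z\<close>
    thus preserves Ulamness cut by cut, and the counted sets coincide.\<close>
  have small: "a < 2 ^ (k + 1)" if "a \<le> y" for a
    using that assms(3) by (rule le_less_trans)
  show "c_ulam y (x + 2 ^ (k + 1)) z = c_ulam y x z"
    unfolding c_ulam_def one_ulam_def[symmetric]
    using small by (simp only: one_ulam_period_left cong: conj_cong)
  show "c_ulam y x z = c_ulam y x (z + 2 ^ (k + 1))"
    unfolding c_ulam_def one_ulam_def[symmetric]
    using small by (simp only: one_ulam_period_right diff_le_self cong: conj_cong)
qed

end
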